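(* Let $G$ be a structured bilinear SISO system given by $\mathcal{C},\mathcal{K},\mathcal{N},\mathcal{B}$, with subsystem transfer functions $G_k$, and let $\widehat G$, with subsystem transfer functions $\widehat G_k$, be the reduced-order bilinear SISO system constructed by projection with $W,V\in\mathbb{C}^{n\times r}$. Let $\sigma_1,\ldots,\sigma_k\in\mathbb{C}$ be interpolation points at which the matrix functions $\mathcal{C}(s)$, $\mathcal{K}(s)^{-1}$, $\mathcal{N}(s)$ and $\mathcal{B}(s)$ are analytic and $\widehat{\mathcal{K}}(s)$ is full-rank, and let $\ell_1,\ldots,\ell_k\ge 0$ be integers. Let \[ v_{1,j_1}=\partial_{s^{j_1}}(\mathcal{K}^{-1}\mathcal{B})(\sigma_1),\qquad j_1=0,\ldots,\ell_1, \] and, for $2\le q\le k$, \[ v_{q,j_q}=\partial_{s^{j_q}}\mathcal{K}^{-1}(\sigma_q)\Big(\prod_{j=1}^{q-2}\partial_{s^{\ell_{q-j}}}(\mathcal{N}\mathcal{K}^{-1})(\sigma_{q-j})\Big)\partial_{s^{\ell_1}}(\mathcal{N}\mathcal{K}^{-1}\mathcal{B})(\sigma_1),\qquad j_q=0,\ldots,\ell_q . \] Let $V$ be such that $\operatorname{span}(V)\supseteq\operatorname{span}([v_{1,0},\ldots,v_{k,\ell_k}])$ (the span of all the vectors $v_{q,j_q}$, $1\le q\le k$, $0\le j_q\le\ell_q$), and let $W$ be an arbitrary full-rank truncation matrix of appropriate dimension. Then \[ \partial_{s_1^{j_1}}G_1(\sigma_1)=\partial_{s_1^{j_1}}\widehat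 G_1(\sigma_1),\qquad j_1=0,\ldots,\ell_1, \] and, for each $2\le q\le k$, \[ \partial_{s_1^{\ell_1}\cdots s_{q-1}^{\ell_{q-1}}s_q^{j_q}}G_q(\sigma_1,\ldots,\sigma_q)=\partial_{s_1^{\ell_1}\cdots s_{q-1}^{\ell_{q-1}}s_q^{j_q}}\widehat G_q(\sigma_1,\ldots,\sigma_q),\qquad j_q=0,\ldots,\ell_q . \]
   Context: A structured bilinear SISO (single-input single-output) system $G$ is described by matrix-valued functions of a complex variable $\mathcal{C}\colon\mathbb{C}\to\mathbb{C}^{1\times n}$, $\mathcal{K}\colon\mathbb{C}\to\mathbb{C}^{n\times n}$, $\mathcal{N}\colon\mathbb{C}\to\mathbb{C}^{n\times n}$, $\mathcal{B}\colon\mathbb{C}\to\mathbb{C}^{n\times 1}$ (which may fail to be defined, or $\mathcal{K}$ may fail to be invertible, at some points), through its regular subsystem transfer functions \[ G_k(s_1,\ldots,s_k)=\mathcal{C}(s_k)\mathcal{K}(s_k)^{-1}\Big(\prod_{j=1}^{k-1}\mathcal{N}(s_{k-j})\mathcal{K}(s_{k-j})^{-1}\Big)\mathcal{B}(s_1),\qquad k\ge 1 . \] Products $\prod_{j=1}^{m}A_j$ of matrices are ordered $A_1A_2\cdots A_m$; empty products are identities. Given model reduction bases (truncation matrices) $W,V\in\mathbb{C}^{n\times r}$, the reduced-order system $\widehat G$ is given by \[ \widehat{\mathcal{C}}(s)=\mathcal{C}(s)V,\quad \widehat{\mathcal{K}}(s)=W^{\mathsf H}\mathcal{K}(s)V,\quad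 \widehat{\mathcal{B}}(s)=W^{\mathsf H}\mathcal{B}(s),\quad \widehat{\mathcal{N}}(s)=W^{\mathsf H}\mathcal{N}(s)V, \] and its transfer functions $\widehat G_k$ are defined by the same formula with hatted quantities. Here $^{\mathsf H}$ is the conjugate transpose and $\operatorname{span}$ of a matrix is its column space. Partial (complex) derivatives are denoted by \[ \partial_{s_1^{j_1}\cdots s_k^{j_k}}f(z_1,\ldots,z_k):=\frac{\partial^{j_1+\cdots+j_k}f}{\partial s_1^{j_1}\cdots\partial s_k^{j_k}}(z_1,\ldots,z_k); \] for a function $F$ of a single variable $s$, $\partial_{s^j}F(\sigma)$ is its $j$-th derivative at $\sigma$. Expressions such as $\mathcal{N}\mathcal{K}^{-1}\mathcal{B}$ denote the pointwise product $s\mapsto\mathcal{N}(s)\mathcal{K}(s)^{-1}\mathcal{B}(s)$. *)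

theory Defs
  imports "HOL-Analysis.Analysis"
begin

text \<open>
  An \<open>n \<times> m\<close> matrix has type \<open>complex^'m^'n\<close>; the values of \<open>C\<close> and \<open>B\<close> are \<open>1 \<times> n\<close> and
  \<open>n \<times> 1\<close> matrices.  Matrix functions that may be undefined at some points are modelled as
  total functions with unconstrained values there.
\<close>

definition conj_transpose :: "complex^'m^'n \<Rightarrow> complex^'n^'m"
  where "conj_transpose A = (\<chi> i j. cnj (A $ j $ i))"

definition full_rank :: "complex^'m^'n \<Rightarrow> bool"
  where "full_rank A \<longleftrightarrow> rank A = min CARD('n) CARD('m)"

definition mat_analytic_at :: "(complex \<Rightarrow> complex^'m^'n) \<Rightarrow> complex \<Rightarrow> bool"
  where "mat_analytic_at F z \<longleftrightarrow> (\<forall>i j. (\<lambda>s. F s $ i $ j) analytic_on {z})"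

text \<open>
  The pointwise inverse is a partial function, and being analytic at \<open>z\<close> includes being defined
  near \<open>z\<close>.  As \<open>matrix_inv\<close> is total and arbitrary on singular matrices, this has to be said
  explicitly.
\<close>
definition mat_inverse_analytic_at :: "(complex \<Rightarrow> complex^'n^'n) \<Rightarrow> complex \<Rightarrow> bool"
  where "mat_inverse_analytic_at K z \<longleftrightarrow>
    (\<forall>\<^sub>F s in nhds z. invertible (K s)) \<and> mat_analytic_at (\<lambda>s. matrix_inv (K s)) z"

definition mat_deriv :: "nat \<Rightarrow> (complex \<Rightarrow> complex^'m^'n) \<Rightarrow> complex \<Rightarrow> complex^'m^'n"
  where "mat_deriv j F z = (\<chi> a b. (deriv ^^ j) (\<lambda>s. F s $ a $ b) z)"

text \<open>\<open>mat_prod m A = A 1 ** A 2 ** \<dots> ** A m\<close>\<close>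
definition mat_prod :: "nat \<Rightarrow> (nat \<Rightarrow> complex^'n^'n) \<Rightarrow> complex^'n^'n"
  where "mat_prod m A = foldr (\<lambda>j P. A j ** P) [1..<Suc m] (mat 1)"

text \<open>
  The \<open>k\<close>-th regular subsystem transfer function.  A point \<open>(s\<^sub>1, \<dots>, s\<^sub>k)\<close> is a function
  on \<open>nat\<close> of which only the values at \<open>1, \<dots>, k\<close> are used; the resulting \<open>1 \<times> 1\<close> matrix is
  identified with its entry.
\<close>
definition transfer_fun ::
  "(complex \<Rightarrow> complex^'n^1) \<Rightarrow> (complex \<Rightarrow> complex^'n^'n) \<Rightarrow> (complex \<Rightarrow> complex^'n^'n)
    \<Rightarrow> (complex \<Rightarrow> complex^1^'n) \<Rightarrow> nat \<Rightarrow> (nat \<Rightarrow> complex) \<Rightarrow> complex"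
  where "transfer_fun C K N B k s =
    (C (s k) ** matrix_inv (K (s k))
      ** mat_prod (k - 1) (\<lambda>j. N (s (k - j)) ** matrix_inv (K (s (k - j))))
      ** B (s 1)) $ 1 $ 1"

definition reduced_transfer_fun ::
  "complex^'r^'n \<Rightarrow> complex^'r^'n
    \<Rightarrow> (complex \<Rightarrow> complex^'n^1) \<Rightarrow> (complex \<Rightarrow> complex^'n^'n) \<Rightarrow> (complex \<Rightarrow> complex^'n^'n)
    \<Rightarrow> (complex \<Rightarrow> complex^1^'n) \<Rightarrow> nat \<Rightarrow> (nat \<Rightarrow> complex) \<Rightarrow> complex"
  where "reduced_transfer_fun W V C K N B =
    transfer_fun
      (\<lambda>s. C s ** V)
      (\<lambda>s. conj_transpose W ** K s ** V)
      (\<lambda>s. conj_transpose W ** N s ** V)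
      (\<lambda>s. conj_transpose W ** B s)"

definition partial_deriv ::
  "nat \<Rightarrow> ((nat \<Rightarrow> complex) \<Rightarrow> complex) \<Rightarrow> (nat \<Rightarrow> complex) \<Rightarrow> complex"
  where "partial_deriv i f z = deriv (\<lambda>w. f (z(i := w))) (z i)"

text \<open>
  \<open>mixed_partial k js f\<close> is \<open>\<partial>\<^sub>1\<close> iterated \<open>js 1\<close> times, applied to \<open>\<partial>\<^sub>2\<close> iterated \<open>js 2\<close> times,
  and so on up to \<open>\<partial>\<^sub>k\<close>, which is applied to \<open>f\<close> first.
\<close>
primrec mixed_partial ::
  "nat \<Rightarrow> (nat \<Rightarrow> nat) \<Rightarrow> ((nat \<Rightarrow> complex) \<Rightarrow> complex) \<Rightarrow> (nat \<Rightarrow> complex) \<Rightarrow> complex"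
  where
    "mixed_partial 0 js f = f"
  | "mixed_partial (Suc k) js f = mixed_partial k js ((partial_deriv (Suc k) ^^ js (Suc k)) f)"

end

theory Submission
  imports Defs "HOL-Complex_Analysis.Cauchy_Integral_Formula"
begin

text \<open>
  Near an interpolation point, \<open>P s = V (W\<^sup>H K(s) V)\<^sup>-\<^sup>1 W\<^sup>H K(s)\<close> is a projection onto the column space
  of \<open>V\<close>, so every derivative of \<open>P - 1\<close> annihilates that space.  By the Leibniz rule, if the
  derivatives of \<open>x = K\<^sup>-\<^sup>1 b\<close> up to order \<open>l\<close> lie in that space, then \<open>P x\<close> and \<open>x\<close> have the same
  derivatives up to order \<open>l\<close>.  A mixed partial derivative of \<open>G\<^sub>q\<close> is a product of matrix derivatives
  in one variable each.  Evaluating such a product from the right, the vector obtained for the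
  reduced system is at each stage \<open>W\<^sup>H\<close> times the one for the full system.
\<close>

section \<open>Matrices\<close>

lemma matrix_inv_mult:
  fixes A :: "'a::field^'n^'n"
  assumes "invertible A"
  shows "A ** matrix_inv A = mat 1" and "matrix_inv A ** A = mat 1"
proof -
  have "\<exists>A'. A ** A' = mat 1 \<and> A' ** A = mat 1"
    using assms by (simp add: invertible_def)
  from someI_ex[OF this] show "A ** matrix_inv A = mat 1" "matrix_inv A ** A = mat 1"
    by (simp_all add: matrix_inv_def)
qed

lemma matrix_inv_unique_right:
  fixes A :: "'a::field^'n^'n"
  assumes "A ** X = mat 1"
  shows "matrix_inv A = X"
proof -
  have "invertible A"
    using assms invertible_right_inverse by blast
  then have "matrix_inv A ** (A ** X) = X"
    by (simp add: matrix_mul_assoc matrix_inv_mult)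
  then show ?thesis
    by (simp add: assms)
qed

text \<open>Cramer's rule for column \<open>j\<close> of the inverse, which solves A x =
  \<open>axis j 1\<close>. Writing the entries as quotients of determinants makes the analyticity of
  the inverse accessible.\<close>

lemma matrix_inv_entry:
  fixes A :: "'a::field^'n^'n"
  assumes "invertible A"
  shows "matrix_inv A $ i $ j =
    det (\<chi> a b. if b = i then (if a = j then 1 else 0) else A $ a $ b) / det A"
proof -
  have "A *v (matrix_inv A *v axis j 1) = axis j 1"
    by (simp add: matrix_vector_mul_assoc matrix_inv_mult assms)
  then have "matrix_inv A *v axis j 1 =
      (\<chi> k. det (\<chi> a b. if b = k then axis j 1 $ a else A $ a $ b) / det A)"
    using cramer[of A] assms invertible_det_nz[of A] by blast
  moreover have "(matrix_inv A *v axis j 1) $ i = matrix_inv A $ i $ j"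
    by (simp add: matrix_vector_mult_def axis_def if_distrib sum.delta cong: if_cong)
  ultimately show ?thesis
    by (simp add: axis_def cong: if_cong)
qed

text \<open>\<open>rank\<close> is the dimension of the row span, so the rows, which are the columns
  of the transpose, span everything. A right inverse of the transpose then transposes into a left
  inverse of \<open>A\<close>.\<close>

lemma full_rank_imp_invertible:
  fixes A :: "complex^'n^'n"
  assumes "full_rank A"
  shows "invertible A"
proof -
  have "vec.dim (rows A) = vec.dimension TYPE(complex) TYPE('n)"
    using assms by (simp add: full_rank_def row_rank_def_gen vec.dimension_def card_cart_basis)
  then have "vec.span (columns (transpose A)) = UNIV"
    using vec.dim_eq_full by (metis columns_transpose)
  then obtain B where "transpose A ** B = mat 1"
    using matrix_right_invertible_span_columns by blast
  then have "transpose B ** A = mat 1"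
    by (metis matrix_transpose_mul transpose_mat transpose_transpose)
  then show ?thesis
    using invertible_left_inverse by blast
qed

text \<open>Turns the span condition on \<open>V\<close> into a factorization, the form in which the
  projection can act on it. Column \<open>i\<close> is \<open>V *v axis i 1\<close>, so the range of
  \<open>V\<close> is a subspace containing all columns.\<close>

lemma span_columns_imp_mult:
  fixes V :: "'a::field^'r^'n" and x :: "'a^1^'n"
  assumes "column 1 x \<in> vec.span (columns V)"
  obtains c :: "'a^1^'r" where "x = V ** c"
proof -
  have "vec.subspace (range ((*v) V))"
    by (intro vec.linear_subspace_image matrix_vector_mul_linear_gen vec.subspace_UNIV)
  moreover have "columns V \<subseteq> range ((*v) V)"
  proof
    fix y assume "y \<in> columns V"
    then obtain i where "y = column i V"
      by (auto simp: columns_def)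
    then have "y = V *v axis i 1"
      by (simp add: vec_eq_iff matrix_vector_mult_def axis_def column_def if_distrib sum.delta
          cong: if_cong)
    then show "y \<in> range ((*v) V)" by blast
  qed
  ultimately have "vec.span (columns V) \<subseteq> range ((*v) V)"
    by (rule vec.span_minimal[rotated])
  then obtain d where d: "column 1 x = V *v d"
    using assms by blast
  have "x = V ** (\<chi> i j. d $ i)"
    using d by (auto simp: vec_eq_iff column_def matrix_vector_mult_def matrix_matrix_mult_def
        forall_1)
  then show ?thesis by (rule that)
qed

section \<open>Analytic matrix functions\<close>

lemma mat_analytic_at_const: "mat_analytic_at (\<lambda>s. A) z"
  by (simp add: mat_analytic_at_def)

lemma mat_analytic_at_mult:
  assumes "mat_analytic_at F z" "mat_analytic_at G z"
  shows "mat_analytic_at (\<lambda>s. F s ** G s) z"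
  using assms by (auto simp: mat_analytic_at_def matrix_matrix_mult_def intro!: analytic_intros)

lemma analytic_at_eventually_eq:
  assumes "f analytic_on {z}" "\<forall>\<^sub>F s in nhds z. f s = g s"
  shows "g analytic_on {z}"
proof -
  obtain S where "open S" "z \<in> S" "f holomorphic_on S"
    using assms(1) analytic_at by blast
  moreover obtain T where "open T" "z \<in> T" "\<forall>s\<in>T. f s = g s"
    using assms(2) by (auto simp: eventually_nhds)
  ultimately have "open (S \<inter> T)" "z \<in> S \<inter> T" "g holomorphic_on S \<inter> T"
    by (auto intro: holomorphic_transform[of f "S \<inter> T"] holomorphic_on_subset)
  then show ?thesis
    using analytic_at by blast
qed

lemma mat_analytic_at_eventually_eq:
  assumes "mat_analytic_at F z" "\<forall>\<^sub>F s in nhds z. F s = G s"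
  shows "mat_analytic_at G z"
  unfolding mat_analytic_at_def
proof (intro allI)
  fix i j
  have "(\<lambda>s. F s $ i $ j) analytic_on {z}"
    using assms(1) by (simp add: mat_analytic_at_def)
  then show "(\<lambda>s. G s $ i $ j) analytic_on {z}"
    by (rule analytic_at_eventually_eq) (use assms(2) in \<open>auto elim: eventually_mono\<close>)
qed

lemma analytic_on_det:
  assumes "\<And>i j. (\<lambda>s. F s $ i $ j) analytic_on S"
  shows "(\<lambda>s. det (F s :: complex^'n^'n)) analytic_on S"
  unfolding det_def by (intro analytic_intros assms)

text \<open>Repeated differentiation needs analyticity on whole neighbourhoods. An open set of
  holomorphy serves all of its points, and there are only finitely many entries.\<close>

lemma eventually_mat_analytic_at:
  assumes "mat_analytic_at F z"
  shows "\<forall>\<^sub>F w in nhds z. mat_analytic_at F w"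
proof -
  have "\<forall>\<^sub>F w in nhds z. (\<lambda>s. F s $ i $ j) analytic_on {w}" for i j
  proof -
    obtain S where "open S" "z \<in> S" "(\<lambda>s. F s $ i $ j) holomorphic_on S"
      using assms by (auto simp: mat_analytic_at_def analytic_at)
    then show ?thesis
      unfolding eventually_nhds analytic_at by blast
  qed
  then show ?thesis
    unfolding mat_analytic_at_def by (intro eventually_all_finite)
qed

lemma eventually_invertible:
  fixes F :: "complex \<Rightarrow> complex^'n^'n"
  assumes "mat_analytic_at F z" "invertible (F z)"
  shows "\<forall>\<^sub>F s in nhds z. invertible (F s)"
proof -
  have "(\<lambda>s. det (F s)) analytic_on {z}"
    using assms(1) by (intro analytic_on_det) (simp add: mat_analytic_at_def)
  then have "isCont (\<lambda>s. det (F s)) z"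
    using analytic_at_imp_isCont by blast
  then have "((\<lambda>s. det (F s)) \<longlongrightarrow> det (F z)) (nhds z)"
    by (simp add: isCont_def tendsto_nhds_iff)
  moreover have "det (F z) \<noteq> 0"
    using assms(2) invertible_det_nz by blast
  ultimately have "\<forall>\<^sub>F s in nhds z. det (F s) \<noteq> 0"
    by (rule tendsto_imp_eventually_ne)
  then show ?thesis
    by (simp add: invertible_det_nz)
qed

text \<open>By Cramer's rule each entry is, near \<open>z\<close>, a quotient of analytic
  determinants whose denominator does not vanish at \<open>z\<close>.\<close>

lemma mat_analytic_at_matrix_inv:
  fixes F :: "complex \<Rightarrow> complex^'n^'n"
  assumes "mat_analytic_at F z" "invertible (F z)"
  shows "mat_analytic_at (\<lambda>s. matrix_inv (F s)) z"
  unfolding mat_analytic_at_def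
proof (intro allI)
  fix i j
  let ?M = "\<lambda>s. \<chi> a b. if b = i then (if a = j then 1 else 0) else F s $ a $ b"
  have "(\<lambda>s. ?M s $ a $ b) analytic_on {z}" for a b
    using assms(1) by (cases "b = i") (simp_all add: mat_analytic_at_def)
  then have "(\<lambda>s. det (?M s) / det (F s)) analytic_on {z}"
    using assms invertible_det_nz[of "F z"]
    by (intro analytic_on_divide analytic_on_det) (simp_all add: mat_analytic_at_def)
  moreover have "\<forall>\<^sub>F s in nhds z. det (?M s) / det (F s) = matrix_inv (F s) $ i $ j"
    using eventually_invertible[OF assms] by eventually_elim (rule matrix_inv_entry[symmetric])
  ultimately show "(\<lambda>s. matrix_inv (F s) $ i $ j) analytic_on {z}"
    by (rule analytic_at_eventually_eq)
qed

text \<open>Near \<open>z\<close>, \<open>K s\<close> is the inverse of an analytic invertible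
  matrix function, so the preceding lemma applies to the inverse. Analyticity is assumed of the
  inverse only, whereas the projection contains \<open>K\<close> itself.\<close>

lemma mat_analytic_at_if_mat_inverse_analytic_at:
  assumes "mat_inverse_analytic_at K z"
  shows "mat_analytic_at K z"
proof -
  have inv: "\<forall>\<^sub>F s in nhds z. invertible (K s)" and an: "mat_analytic_at (\<lambda>s. matrix_inv (K s)) z"
    using assms by (auto simp: mat_inverse_analytic_at_def)
  have "invertible (matrix_inv (K z))"
    using matrix_inv_mult[OF eventually_nhds_x_imp_x[OF inv]] invertible_def by blast
  then have "mat_analytic_at (\<lambda>s. matrix_inv (matrix_inv (K s))) z"
    by (rule mat_analytic_at_matrix_inv[OF an])
  moreover have "\<forall>\<^sub>F s in nhds z. matrix_inv (matrix_inv (K s)) = K s"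
    using inv by eventually_elim (simp add: matrix_inv_unique_right matrix_inv_mult)
  ultimately show ?thesis
    by (rule mat_analytic_at_eventually_eq)
qed

section \<open>Derivatives of matrix functions\<close>

lemma mat_deriv_0 [simp]: "mat_deriv 0 F z = F z"
  by (simp add: mat_deriv_def vec_eq_iff)

lemma mat_deriv_Suc: "mat_deriv (Suc j) F z = mat_deriv 1 (mat_deriv j F) z"
  by (simp add: mat_deriv_def vec_eq_iff)

lemma mat_analytic_at_mat_deriv:
  "mat_analytic_at F z \<Longrightarrow> mat_analytic_at (mat_deriv j F) z"
  by (simp add: mat_analytic_at_def mat_deriv_def analytic_higher_deriv)

lemma mat_deriv_cong:
  assumes "\<forall>\<^sub>F s in nhds z. F s = G s"
  shows "mat_deriv j F z = mat_deriv j G z"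
proof -
  have "(deriv ^^ j) (\<lambda>s. F s $ a $ b) z = (deriv ^^ j) (\<lambda>s. G s $ a $ b) z" for a b
    by (rule higher_deriv_cong_ev) (use assms in \<open>auto elim: eventually_mono\<close>)
  then show ?thesis
    by (simp add: mat_deriv_def)
qed

lemma mat_deriv_const: "mat_deriv j (\<lambda>s. A) z = (if j = 0 then A else 0)"
  by (simp add: mat_deriv_def vec_eq_iff)

lemma higher_deriv_sum_analytic:
  assumes "finite I" "\<And>i. i \<in> I \<Longrightarrow> f i analytic_on {z}"
  shows "(deriv ^^ j) (\<lambda>s. \<Sum>i\<in>I. f i s) z = (\<Sum>i\<in>I. (deriv ^^ j) (f i) z)"
  using assms
proof (induction I rule: finite_induct)
  case (insert i I)
  have "(deriv ^^ j) (\<lambda>s. f i s + (\<Sum>i\<in>I. f i s)) z =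
      (deriv ^^ j) (f i) z + (deriv ^^ j) (\<lambda>s. \<Sum>i\<in>I. f i s) z"
    using insert.prems by (intro higher_deriv_add_at analytic_on_sum) auto
  then show ?case
    using insert by simp
qed simp

text \<open>The scalar Leibniz rule in each summand of the matrix product, followed by an exchange
  of the two sums. The entrywise form lets the binomial coefficients multiply complex
  numbers.\<close>

lemma mat_deriv_mult:
  assumes "mat_analytic_at F z" "mat_analytic_at G z"
  shows "mat_deriv j (\<lambda>s. F s ** G s) z $ a $ b =
    (\<Sum>i\<le>j. of_nat (j choose i) * (mat_deriv i F z ** mat_deriv (j - i) G z) $ a $ b)"
proof -
  have F: "(\<lambda>s. F s $ a $ c) analytic_on {z}" and G: "(\<lambda>s. G s $ c $ b) analytic_on {z}" for c
    using assms by (auto simp: mat_analytic_at_def)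
  have "mat_deriv j (\<lambda>s. F s ** G s) z $ a $ b =
      (\<Sum>c\<in>UNIV. (deriv ^^ j) (\<lambda>s. F s $ a $ c * G s $ c $ b) z)"
    by (simp add: mat_deriv_def matrix_matrix_mult_def)
      (intro higher_deriv_sum_analytic analytic_on_mult F G finite)
  also have "\<dots> = (\<Sum>c\<in>UNIV. \<Sum>i\<le>j. of_nat (j choose i) *
      (deriv ^^ i) (\<lambda>s. F s $ a $ c) z * (deriv ^^ (j - i)) (\<lambda>s. G s $ c $ b) z)"
    by (simp add: higher_deriv_mult_at[OF F G] atMost_atLeast0)
  also have "\<dots> = (\<Sum>i\<le>j. of_nat (j choose i) * (mat_deriv i F z ** mat_deriv (j - i) G z) $ a $ b)"
    by (subst sum.swap) (simp add: mat_deriv_def matrix_matrix_mult_def sum_distrib_left mult.assoc)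
  finally show ?thesis .
qed

text \<open>Higher derivatives of a constant vanish, so only the term \<open>i = 0\<close> of the
  Leibniz sum survives; for a constant on the right it is the term \<open>i = j\<close>.\<close>

lemma mat_deriv_mult_left:
  assumes "mat_analytic_at F z"
  shows "mat_deriv j (\<lambda>s. A ** F s) z = A ** mat_deriv j F z"
proof -
  have "mat_deriv j (\<lambda>s. A ** F s) z $ a $ b = (A ** mat_deriv j F z) $ a $ b" for a b
  proof -
    have "mat_deriv j (\<lambda>s. A ** F s) z $ a $ b =
        (\<Sum>i\<le>j. if i = 0 then (A ** mat_deriv j F z) $ a $ b else 0)"
      unfolding mat_deriv_mult[OF mat_analytic_at_const assms]
      by (intro sum.cong) (auto simp: mat_deriv_const matrix_matrix_mult_def)
    then show ?thesis by simp
  qed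
  then show ?thesis by (simp add: vec_eq_iff)
qed

lemma mat_deriv_mult_right:
  assumes "mat_analytic_at F z"
  shows "mat_deriv j (\<lambda>s. F s ** A) z = mat_deriv j F z ** A"
proof -
  have "mat_deriv j (\<lambda>s. F s ** A) z $ a $ b = (mat_deriv j F z ** A) $ a $ b" for a b
  proof -
    have "mat_deriv j (\<lambda>s. F s ** A) z $ a $ b =
        (\<Sum>i\<le>j. if i = j then (mat_deriv j F z ** A) $ a $ b else 0)"
      unfolding mat_deriv_mult[OF assms mat_analytic_at_const]
      by (intro sum.cong) (auto simp: mat_deriv_const matrix_matrix_mult_def)
    then show ?thesis by simp
  qed
  then show ?thesis by (simp add: vec_eq_iff)
qed

text \<open>The Leibniz sum of order \<open>j\<close> involves the second factor only through
  derivatives of order at most \<open>l\<close>, where \<open>X\<close> and \<open>Y\<close>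
  agree.\<close>

lemma mat_deriv_mult_cong:
  assumes "mat_analytic_at F z" "mat_analytic_at X z" "mat_analytic_at Y z"
    and "\<And>j. j \<le> l \<Longrightarrow> mat_deriv j X z = mat_deriv j Y z" "j \<le> l"
  shows "mat_deriv j (\<lambda>s. F s ** X s) z = mat_deriv j (\<lambda>s. F s ** Y s) z"
  by (simp add: vec_eq_iff mat_deriv_mult assms(1-3))
    (use assms(4,5) in \<open>simp add: vec_eq_iff [symmetric]\<close>)

section \<open>Mixed partial derivatives of matrix products\<close>

text \<open>With the other variables frozen, only the middle factor depends on coordinate
  \<open>i\<close>, and the constants \<open>L\<close> and \<open>R\<close> can be pulled out. The
  claim covers all of \<open>U\<close> because each further derivative needs the previous one on a
  neighbourhood.\<close>

lemma partial_deriv_iterate_product: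
  assumes "open U" "\<And>w. w \<in> U \<Longrightarrow> mat_analytic_at F w"
    and "\<And>w. w \<in> U \<Longrightarrow> f (z(i := w)) = (L ** F w ** R) $ 1 $ 1"
    and "w \<in> U"
  shows "(partial_deriv i ^^ j) f (z(i := w)) = (L ** mat_deriv j F w ** R) $ 1 $ 1"
  using \<open>w \<in> U\<close>
proof (induction j arbitrary: w)
  case 0
  then show ?case using assms(3) by (simp del: fun_upd_apply)
next
  case (Suc j)
  let ?G = "mat_deriv j F"
  have G: "mat_analytic_at ?G w"
    using assms(2) Suc.prems by (intro mat_analytic_at_mat_deriv)
  have "(partial_deriv i ^^ Suc j) f (z(i := w)) =
      deriv (\<lambda>u. (partial_deriv i ^^ j) f (z(i := u))) w"
    by (simp add: partial_deriv_def)
  also have "\<dots> = deriv (\<lambda>u. (L ** ?G u ** R) $ 1 $ 1) w"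
    by (rule deriv_cong_ev) (use Suc assms(1) in \<open>auto simp: eventually_nhds simp del: fun_upd_apply\<close>)
  also have "\<dots> = mat_deriv 1 (\<lambda>u. L ** ?G u ** R) w $ 1 $ 1"
    by (simp add: mat_deriv_def)
  also have "\<dots> = (L ** mat_deriv (Suc j) F w ** R) $ 1 $ 1"
    unfolding mat_deriv_Suc[of j F]
    using G by (simp add: mat_deriv_mult_right mat_deriv_mult_left mat_analytic_at_mult
        mat_analytic_at_const)
  finally show ?case .
qed

text \<open>\<open>mat_chain m A Y = A (m + 1) ** \<dots> ** A 2 ** Y\<close>: the index \<open>1\<close> is left out because in \<open>G\<^sub>q\<close> the
  first variable also occurs in \<open>B\<close>, so that \<open>N K\<^sup>-\<^sup>1 B\<close> has to be differentiated as a whole.\<close>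
primrec mat_chain :: "nat \<Rightarrow> (nat \<Rightarrow> 'a::semiring_1^'n^'n) \<Rightarrow> 'a^'m^'n \<Rightarrow> 'a^'m^'n" where
  "mat_chain 0 A Y = Y"
| "mat_chain (Suc m) A Y = A (Suc (Suc m)) ** mat_chain m A Y"

lemma mat_chain_cong:
  "(\<And>i. i \<in> {2..Suc m} \<Longrightarrow> A i = A' i) \<Longrightarrow> mat_chain m A Y = mat_chain m A' Y"
  by (induction m) auto

lemma mat_prod_Suc: "mat_prod (Suc m) A = A 1 ** mat_prod m (\<lambda>j. A (Suc j))"
proof -
  have "[1..<Suc (Suc m)] = 1 # map Suc [1..<Suc m]"
    by (simp only: map_Suc_upt) (simp add: upt_rec del: upt_Suc)
  then show ?thesis
    unfolding mat_prod_def by (simp add: foldr_map o_def del: upt_Suc)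
qed

text \<open>With q = m + 2 this is the product in the definition of the vectors v_q: the index runs
  from q - 1 down to 2.\<close>

lemma mat_prod_eq_mat_chain: "mat_prod m (\<lambda>j. M (Suc (Suc m) - j)) ** Y = mat_chain m M Y"
proof (induction m)
  case 0
  then show ?case by (simp add: mat_prod_def)
next
  case (Suc m)
  then show ?case by (simp add: mat_prod_Suc flip: matrix_mul_assoc)
qed

text \<open>The product in G_q has one factor more than that in v_q, the one of index 1, which is
  absorbed into the starting vector.\<close>

lemma mat_prod_Suc_eq_mat_chain:
  "mat_prod (Suc m) (\<lambda>j. M (Suc (Suc m) - j)) ** Y = mat_chain m M (M 1 ** Y)"
proof (induction m)
  case 0
  then show ?case by (simp add: mat_prod_def)
next
  case (Suc m)
  then show ?case by (simp add: mat_prod_Suc[of "Suc m"] flip: matrix_mul_assoc)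
qed

text \<open>Induction with \<open>L\<close> and \<open>f\<close> arbitrary: differentiating in the
  last variable first turns the leftmost factor into a constant matrix, which joins
  \<open>L\<close>. The product form of \<open>f\<close> is required only where the variables
  outside the range equal those of \<sigma>, since those already differentiated have been evaluated
  there.\<close>

lemma mixed_partial_mat_chain:
  fixes A :: "complex \<Rightarrow> complex^'n^'n" and b :: "complex \<Rightarrow> complex^1^'n"
    and L :: "complex^'n^1"
  assumes U: "\<And>i. i \<in> {1..Suc m} \<Longrightarrow> open (U i) \<and> \<sigma> i \<in> U i"
    and A: "\<And>i w. i \<in> {1..Suc m} \<Longrightarrow> w \<in> U i \<Longrightarrow> mat_analytic_at A w"
    and b: "\<And>w. w \<in> U 1 \<Longrightarrow> mat_analytic_at b w"
    and f: "\<And>s. (\<And>i. i \<in> {1..Suc m} \<Longrightarrow> s i \<in> U i) \<Longrightarrow> (\<And>i. i \<notin> {1..Suc m} \<Longrightarrow> s i = \<sigma> i)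
      \<Longrightarrow> f s = (L ** mat_chain m (\<lambda>i. A (s i)) (b (s 1))) $ 1 $ 1"
  shows "mixed_partial (Suc m) js f \<sigma> =
    (L ** mat_chain m (\<lambda>i. mat_deriv (js i) A (\<sigma> i)) (mat_deriv (js 1) b (\<sigma> 1))) $ 1 $ 1"
  using U A f
proof (induction m arbitrary: L f)
  case 0
  have "(partial_deriv 1 ^^ js 1) f (\<sigma>(1 := \<sigma> 1)) =
      (L ** mat_deriv (js 1) b (\<sigma> 1) ** mat 1) $ 1 $ 1"
    by (rule partial_deriv_iterate_product[where U = "U 1"]) (use 0 b in auto)
  then show ?case by simp
next
  case (Suc m)
  let ?q = "Suc (Suc m)"
  have U: "open (U i) \<and> \<sigma> i \<in> U i" if "i \<in> {1..Suc m}" for i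
    using Suc.prems(1)[of i] that by simp
  have A: "mat_analytic_at A w" if "i \<in> {1..Suc m}" "w \<in> U i" for i w
    using Suc.prems(2)[of i w] that by simp
  have "mixed_partial (Suc m) js ((partial_deriv ?q ^^ js ?q) f) \<sigma> =
    (L ** mat_deriv (js ?q) A (\<sigma> ?q) **
      mat_chain m (\<lambda>i. mat_deriv (js i) A (\<sigma> i)) (mat_deriv (js 1) b (\<sigma> 1))) $ 1 $ 1"
  proof (rule Suc.IH[OF U A])
    fix s
    assume s: "\<And>i. i \<in> {1..Suc m} \<Longrightarrow> s i \<in> U i" "\<And>i. i \<notin> {1..Suc m} \<Longrightarrow> s i = \<sigma> i"
    let ?R = "mat_chain m (\<lambda>i. A (s i)) (b (s 1))"
    have "(partial_deriv ?q ^^ js ?q) f (s(?q := \<sigma> ?q)) =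
        (L ** mat_deriv (js ?q) A (\<sigma> ?q) ** ?R) $ 1 $ 1"
    proof (rule partial_deriv_iterate_product[where U = "U ?q"])
      fix w assume w: "w \<in> U ?q"
      have "f (s(?q := w)) = (L ** mat_chain (Suc m) (\<lambda>i. A ((s(?q := w)) i)) (b ((s(?q := w)) 1))) $ 1 $ 1"
        by (rule Suc.prems(3)) (use s w in \<open>auto simp: le_Suc_eq\<close>)
      also have "mat_chain m (\<lambda>i. A ((s(?q := w)) i)) (b (s 1)) = ?R"
        by (rule mat_chain_cong) auto
      then have "mat_chain (Suc m) (\<lambda>i. A ((s(?q := w)) i)) (b ((s(?q := w)) 1)) = A w ** ?R"
        by simp
      finally show "f (s(?q := w)) = (L ** A w ** ?R) $ 1 $ 1"
        by (simp add: matrix_mul_assoc del: fun_upd_apply)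
    qed (use Suc.prems(1)[of ?q] Suc.prems(2)[of ?q] in auto)
    \<comment> \<open>Index \<open>?q\<close> lies outside the range of the induction hypothesis, so
      \<open>s\<close> already agrees with \<sigma> there.\<close>
    moreover have "s(?q := \<sigma> ?q) = s"
      using s(2)[of ?q] by (simp add: fun_upd_idem)
    ultimately show "(partial_deriv ?q ^^ js ?q) f s =
        (L ** mat_deriv (js ?q) A (\<sigma> ?q) ** ?R) $ 1 $ 1"
      by simp
  qed
  then show ?case
    by (simp add: matrix_mul_assoc)
qed

lemma mixed_partial_transfer_fun_1:
  assumes "mat_analytic_at C (\<sigma> 1)" "mat_analytic_at (\<lambda>s. matrix_inv (K s)) (\<sigma> 1)"
    "mat_analytic_at B (\<sigma> 1)"
  shows "mixed_partial 1 js (transfer_fun C K N B 1) \<sigma> =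
    mat_deriv (js 1) (\<lambda>s. C s ** matrix_inv (K s) ** B s) (\<sigma> 1) $ 1 $ 1"
proof -
  let ?F = "\<lambda>s. C s ** matrix_inv (K s) ** B s"
  have "\<forall>\<^sub>F w in nhds (\<sigma> 1). mat_analytic_at ?F w"
    using assms by (intro eventually_mat_analytic_at mat_analytic_at_mult)
  then obtain U where "open U" "\<sigma> 1 \<in> U" "\<And>w. w \<in> U \<Longrightarrow> mat_analytic_at ?F w"
    by (auto simp: eventually_nhds)
  then have "(partial_deriv 1 ^^ js 1) (transfer_fun C K N B 1) (\<sigma>(1 := \<sigma> 1)) =
      (mat 1 ** mat_deriv (js 1) ?F (\<sigma> 1) ** mat 1) $ 1 $ 1"
    by (intro partial_deriv_iterate_product[where U = U])
      (simp_all add: transfer_fun_def mat_prod_def)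
  then show ?thesis by simp
qed

text \<open>The last variable enters through \<open>C\<close> instead of \<open>N\<close>. It is
  therefore differentiated separately, and the result serves as the constant \<open>L\<close> for
  the chain in the remaining variables.\<close>

lemma mixed_partial_transfer_fun:
  fixes C :: "complex \<Rightarrow> complex^'n^1"
  assumes "q = Suc (Suc m)"
    and C: "\<And>i. i \<in> {1..q} \<Longrightarrow> mat_analytic_at C (\<sigma> i)"
    and K: "\<And>i. i \<in> {1..q} \<Longrightarrow> mat_analytic_at (\<lambda>s. matrix_inv (K s)) (\<sigma> i)"
    and N: "\<And>i. i \<in> {1..q} \<Longrightarrow> mat_analytic_at N (\<sigma> i)"
    and B: "\<And>i. i \<in> {1..q} \<Longrightarrow> mat_analytic_at B (\<sigma> i)"
  shows "mixed_partial q js (transfer_fun C K N B q) \<sigma> =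
    (mat_deriv (js q) (\<lambda>s. C s ** matrix_inv (K s)) (\<sigma> q) **
      mat_chain m (\<lambda>i. mat_deriv (js i) (\<lambda>s. N s ** matrix_inv (K s)) (\<sigma> i))
        (mat_deriv (js 1) (\<lambda>s. N s ** matrix_inv (K s) ** B s) (\<sigma> 1))) $ 1 $ 1"
proof -
  let ?F = "\<lambda>s. C s ** matrix_inv (K s)" and ?A = "\<lambda>s. N s ** matrix_inv (K s)"
  let ?b = "\<lambda>s. ?A s ** B s"
  let ?G = "transfer_fun C K N B q"
  have "\<exists>U. open U \<and> \<sigma> i \<in> U \<and>
      (\<forall>w\<in>U. mat_analytic_at ?F w \<and> mat_analytic_at ?A w \<and> mat_analytic_at ?b w)"
    if "i \<in> {1..q}" for i
  proof -
    have "mat_analytic_at ?F (\<sigma> i)" "mat_analytic_at ?A (\<sigma> i)" "mat_analytic_at ?b (\<sigma> i)"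
      by (intro mat_analytic_at_mult C K N B that)+
    then show ?thesis
      unfolding eventually_nhds[symmetric]
      by (intro eventually_conj eventually_mat_analytic_at)
  qed
  then have "\<forall>i\<in>{1..q}. \<exists>U. open U \<and> \<sigma> i \<in> U \<and>
      (\<forall>w\<in>U. mat_analytic_at ?F w \<and> mat_analytic_at ?A w \<and> mat_analytic_at ?b w)"
    by (rule ballI)
  from bchoice[OF this] obtain U where U: "\<And>i. i \<in> {1..q} \<Longrightarrow> open (U i) \<and> \<sigma> i \<in> U i \<and>
      (\<forall>w\<in>U i. mat_analytic_at ?F w \<and> mat_analytic_at ?A w \<and> mat_analytic_at ?b w)"
    by blast
  have U': "i \<in> {1..Suc m} \<Longrightarrow> open (U i) \<and> \<sigma> i \<in> U i"
    and A: "i \<in> {1..Suc m} \<Longrightarrow> w \<in> U i \<Longrightarrow> mat_analytic_at ?A w"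
    and b: "w \<in> U 1 \<Longrightarrow> mat_analytic_at ?b w" for i w
    using U[of i] U[of 1] \<open>q = _\<close> by auto
  have G: "?G s = (?F (s q) ** mat_chain m (\<lambda>i. ?A (s i)) (?b (s 1))) $ 1 $ 1" for s
    using mat_prod_Suc_eq_mat_chain[of m "\<lambda>i. ?A (s i)" "B (s 1)"]
    by (simp add: transfer_fun_def \<open>q = _\<close> flip: matrix_mul_assoc)
  have "mixed_partial (Suc m) js ((partial_deriv q ^^ js q) ?G) \<sigma> =
    (mat_deriv (js q) ?F (\<sigma> q) **
      mat_chain m (\<lambda>i. mat_deriv (js i) ?A (\<sigma> i)) (mat_deriv (js 1) ?b (\<sigma> 1))) $ 1 $ 1"
  proof (rule mixed_partial_mat_chain[OF U' A b])
    fix s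
    assume s: "\<And>i. i \<in> {1..Suc m} \<Longrightarrow> s i \<in> U i" "\<And>i. i \<notin> {1..Suc m} \<Longrightarrow> s i = \<sigma> i"
    let ?R = "mat_chain m (\<lambda>i. ?A (s i)) (?b (s 1))"
    have "(partial_deriv q ^^ js q) ?G (s(q := \<sigma> q)) =
        (mat 1 ** mat_deriv (js q) ?F (\<sigma> q) ** ?R) $ 1 $ 1"
    proof (rule partial_deriv_iterate_product[where U = "U q"])
      fix w assume w: "w \<in> U q"
      have "mat_chain m (\<lambda>i. ?A ((s(q := w)) i)) (?b (s 1)) = ?R"
        by (rule mat_chain_cong) (auto simp: \<open>q = _\<close>)
      then show "?G (s(q := w)) = (mat 1 ** ?F w ** ?R) $ 1 $ 1"
        unfolding G by (simp add: \<open>q = _\<close>)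
    qed (use U \<open>q = _\<close> in auto)
    moreover have "s(q := \<sigma> q) = s"
      using s(2)[of q] by (simp add: fun_upd_idem \<open>q = _\<close>)
    ultimately show "(partial_deriv q ^^ js q) ?G s =
        (mat_deriv (js q) ?F (\<sigma> q) ** ?R) $ 1 $ 1"
      by simp
  qed
  then show ?thesis
    by (simp add: \<open>q = _\<close>)
qed

section \<open>Interpolation by projection\<close>

text \<open>Used at every stage of the evaluation from the right: \<open>F\<close> is
  \<open>C\<close> at the output and \<open>conj_transpose W ** N s\<close> in between, while
  \<open>b\<close> is \<open>B\<close> at the first stage and a constant vector later.\<close>

lemma mat_deriv_projected_solution:
  fixes K :: "complex \<Rightarrow> complex^'n^'n" and V :: "complex^'r^'n" and H :: "complex^'n^'r"
    and F :: "complex \<Rightarrow> complex^'n^'p" and b :: "complex \<Rightarrow> complex^'m^'n"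
  assumes K: "mat_inverse_analytic_at K z" and inv: "invertible (H ** K z ** V)"
    and F: "mat_analytic_at F z" and b: "mat_analytic_at b z"
    and V: "\<And>j. j \<le> l \<Longrightarrow> \<exists>c. mat_deriv j (\<lambda>s. matrix_inv (K s) ** b s) z = V ** c"
    and "j \<le> l"
  shows "mat_deriv j (\<lambda>s. F s ** V ** matrix_inv (H ** K s ** V) ** (H ** b s)) z =
    mat_deriv j (\<lambda>s. F s ** matrix_inv (K s) ** b s) z"
proof -
  let ?x = "\<lambda>s. matrix_inv (K s) ** b s"
  let ?P = "\<lambda>s. V ** matrix_inv (H ** K s ** V) ** H ** K s"
  have Ka: "mat_analytic_at K z" and Ki: "\<forall>\<^sub>F s in nhds z. invertible (K s)"
    and x: "mat_analytic_at ?x z"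
    using K b mat_analytic_at_if_mat_inverse_analytic_at
    by (auto simp: mat_inverse_analytic_at_def intro: mat_analytic_at_mult)
  have an: "mat_analytic_at (\<lambda>s. H ** K s ** V) z"
    by (intro mat_analytic_at_mult mat_analytic_at_const Ka)
  have P: "mat_analytic_at ?P z"
    by (intro mat_analytic_at_mult mat_analytic_at_const Ka mat_analytic_at_matrix_inv an inv)
  have "\<forall>\<^sub>F s in nhds z. ?P s ** V = mat 1 ** V"
    using eventually_invertible[OF an inv]
  proof eventually_elim
    case (elim s)
    have "?P s ** V = V ** (matrix_inv (H ** K s ** V) ** (H ** K s ** V))"
      by (simp add: matrix_mul_assoc)
    then show ?case
      by (simp only: matrix_inv_mult[OF elim] matrix_mul_rid matrix_mul_lid)
  qed
  \<comment> \<open>Keeping the derivative of the constant identity unevaluated treats order 0 and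
    the higher orders, where it is zero, alike.\<close>
  then have PV: "mat_deriv i ?P z ** V = mat_deriv i (\<lambda>s. mat 1) z ** V" for i
    using mat_deriv_cong[of "\<lambda>s. ?P s ** V" "\<lambda>s. mat 1 ** V" z i]
    by (simp only: mat_deriv_mult_right P mat_analytic_at_const)
  have Px: "mat_deriv j (\<lambda>s. ?P s ** ?x s) z = mat_deriv j ?x z" if jl: "j \<le> l" for j
  proof -
    \<comment> \<open>Truncated subtraction keeps \<open>j - i\<close> at most \<open>l\<close> for
      every \<open>i\<close>, so this derivative of \<open>?x\<close> always factors through
      \<open>V\<close>.\<close>
    have "mat_deriv i ?P z ** mat_deriv (j - i) ?x z =
        mat_deriv i (\<lambda>s. mat 1) z ** mat_deriv (j - i) ?x z" for i
    proof -
      obtain c where "mat_deriv (j - i) ?x z = V ** c"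
        using V[OF order_trans[OF diff_le_self jl]] by blast
      then show ?thesis
        by (simp only: matrix_mul_assoc PV)
    qed
    then have "mat_deriv j (\<lambda>s. ?P s ** ?x s) z = mat_deriv j (\<lambda>s. mat 1 ** ?x s) z"
      by (simp only: vec_eq_iff mat_deriv_mult[OF P x] mat_deriv_mult[OF mat_analytic_at_const x]
          simp_thms)
    then show ?thesis by simp
  qed
  have "\<forall>\<^sub>F s in nhds z. F s ** V ** matrix_inv (H ** K s ** V) ** (H ** b s) =
      F s ** (?P s ** ?x s)"
    using Ki
  proof eventually_elim
    case (elim s)
    have "b s = K s ** matrix_inv (K s) ** b s"
      by (simp add: matrix_inv_mult[OF elim])
    then show ?case
      by (metis matrix_mul_assoc)
  qed
  then have "mat_deriv j (\<lambda>s. F s ** V ** matrix_inv (H ** K s ** V) ** (H ** b s)) z =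
      mat_deriv j (\<lambda>s. F s ** (?P s ** ?x s)) z"
    by (rule mat_deriv_cong)
  also have "\<dots> = mat_deriv j (\<lambda>s. F s ** ?x s) z"
    by (rule mat_deriv_mult_cong[OF F mat_analytic_at_mult[OF P x] x Px \<open>j \<le> l\<close>])
  finally show ?thesis
    by (simp add: matrix_mul_assoc)
qed

theorem theorem4:
  fixes C :: "complex \<Rightarrow> complex^'n^1"
    and K :: "complex \<Rightarrow> complex^'n^'n"
    and N :: "complex \<Rightarrow> complex^'n^'n"
    and B :: "complex \<Rightarrow> complex^1^'n"
    and W V :: "complex^'r^'n"
    and k :: nat
    and \<sigma> :: "nat \<Rightarrow> complex"
    and l :: "nat \<Rightarrow> nat"
    and v :: "nat \<Rightarrow> nat \<Rightarrow> complex^1^'n"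
  assumes "k \<ge> 1"
    and "\<And>q. q \<in> {1..k} \<Longrightarrow> mat_analytic_at C (\<sigma> q)"
    and "\<And>q. q \<in> {1..k} \<Longrightarrow> mat_inverse_analytic_at K (\<sigma> q)"
    and "\<And>q. q \<in> {1..k} \<Longrightarrow> mat_analytic_at N (\<sigma> q)"
    and "\<And>q. q \<in> {1..k} \<Longrightarrow> mat_analytic_at B (\<sigma> q)"
    and "\<And>q. q \<in> {1..k} \<Longrightarrow> full_rank (conj_transpose W ** K (\<sigma> q) ** V)"
    and "\<And>j. j \<le> l 1 \<Longrightarrow> v 1 j = mat_deriv j (\<lambda>s. matrix_inv (K s) ** B s) (\<sigma> 1)"
    and "\<And>q j. q \<in> {2..k} \<Longrightarrow> j \<le> l q \<Longrightarrow>
      v q j = mat_deriv j (\<lambda>s. matrix_inv (K s)) (\<sigma> q)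
        ** mat_prod (q - 2) (\<lambda>i. mat_deriv (l (q - i)) (\<lambda>s. N s ** matrix_inv (K s)) (\<sigma> (q - i)))
        ** mat_deriv (l 1) (\<lambda>s. N s ** matrix_inv (K s) ** B s) (\<sigma> 1)"
    and "vec.span {column 1 (v q j) | q j. q \<in> {1..k} \<and> j \<le> l q} \<subseteq> vec.span (columns V)"
    and "full_rank W"
  shows "(\<forall>j \<le> l 1.
        mixed_partial 1 (l(1 := j)) (transfer_fun C K N B 1) \<sigma> =
        mixed_partial 1 (l(1 := j)) (reduced_transfer_fun W V C K N B 1) \<sigma>) \<and>
    (\<forall>q \<in> {2..k}. \<forall>j \<le> l q.
        mixed_partial q (l(q := j)) (transfer_fun C K N B q) \<sigma> =
        mixed_partial q (l(q := j)) (reduced_transfer_fun W V C K N B q) \<sigma>)"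
proof -
  let ?H = "conj_transpose W" and ?E = "\<lambda>s. matrix_inv (K s)"
  let ?Kr = "\<lambda>s. ?H ** K s ** V"
  let ?Er = "\<lambda>s. matrix_inv (?Kr s)"
  let ?Nr = "\<lambda>s. ?H ** N s ** V"
  let ?Br = "\<lambda>s. ?H ** B s"
  let ?a = "\<lambda>i. mat_deriv (l i) (\<lambda>s. N s ** ?E s) (\<sigma> i)"
  let ?ar = "\<lambda>i. mat_deriv (l i) (\<lambda>s. ?Nr s ** ?Er s) (\<sigma> i)"
  let ?Y = "mat_deriv (l 1) (\<lambda>s. N s ** ?E s ** B s) (\<sigma> 1)"
  let ?Yr = "mat_deriv (l 1) (\<lambda>s. ?Nr s ** ?Er s ** ?Br s) (\<sigma> 1)"
  have one: "1 \<in> {1..k}"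
    using assms(1) by simp
  note C = assms(2) and K = assms(3) and N = assms(4) and B = assms(5)
  have E: "mat_analytic_at ?E (\<sigma> q)" if "q \<in> {1..k}" for q
    using K[OF that] by (simp add: mat_inverse_analytic_at_def)
  have inv: "invertible (?Kr (\<sigma> q))" if "q \<in> {1..k}" for q
    using assms(6)[OF that] by (rule full_rank_imp_invertible)
  have Er: "mat_analytic_at ?Er (\<sigma> q)" if "q \<in> {1..k}" for q
    by (intro mat_analytic_at_matrix_inv inv mat_analytic_at_mult mat_analytic_at_const
        mat_analytic_at_if_mat_inverse_analytic_at K that)
  have Cr: "mat_analytic_at (\<lambda>s. C s ** V) (\<sigma> q)" and Nr: "mat_analytic_at ?Nr (\<sigma> q)"
    and Br: "mat_analytic_at ?Br (\<sigma> q)" if "q \<in> {1..k}" for q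
    by (intro mat_analytic_at_mult mat_analytic_at_const C N B that)+
  have v: "\<exists>c. v q j = V ** c" if "q \<in> {1..k}" "j \<le> l q" for q j
  proof -
    have "column 1 (v q j) \<in> vec.span (columns V)"
      using assms(9) that by (blast intro: vec.span_base)
    then show ?thesis
      by (rule span_columns_imp_mult) blast
  qed
  have v1: "\<exists>c. mat_deriv j (\<lambda>s. ?E s ** B s) (\<sigma> 1) = V ** c" if "j \<le> l 1" for j
    using v[OF one that] assms(7)[OF that] by simp
  \<comment> \<open>The chain does not depend on \<open>s\<close>, so v_q,j is the derivative of
    order \<open>j\<close> of the solution with this constant right-hand side, as the projection
    lemma requires.\<close>
  have vq: "\<exists>c. mat_deriv j (\<lambda>s. ?E s ** mat_chain m ?a ?Y) (\<sigma> q) = V ** c"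
    if "q = Suc (Suc m)" "q \<in> {2..k}" "j \<le> l q" for q m j
  proof -
    have q: "q \<in> {1..k}" using that by simp
    have "v q j = mat_deriv j ?E (\<sigma> q) ** mat_chain m ?a ?Y"
      using assms(8)[OF that(2,3)] mat_prod_eq_mat_chain[of m ?a ?Y]
      by (simp add: that(1) flip: matrix_mul_assoc)
    then show ?thesis
      using v[OF q that(3)] by (simp add: mat_deriv_mult_right E[OF q])
  qed
  have chain: "mat_chain m ?ar ?Yr = ?H ** mat_chain m ?a ?Y" if "Suc m \<le> k" for m
    using that
  proof (induction m)
    case 0
    have "?Yr = mat_deriv (l 1) (\<lambda>s. ?H ** N s ** ?E s ** B s) (\<sigma> 1)"
      by (rule mat_deriv_projected_solution[OF K inv _ B v1])
        (use one in \<open>auto intro!: mat_analytic_at_mult mat_analytic_at_const N\<close>)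
    also have "\<dots> = mat_deriv (l 1) (\<lambda>s. ?H ** (N s ** ?E s ** B s)) (\<sigma> 1)"
      by (simp add: matrix_mul_assoc)
    also have "\<dots> = ?H ** ?Y"
      by (intro mat_deriv_mult_left mat_analytic_at_mult N E B one)
    finally show ?case by simp
  next
    case (Suc m)
    define q where "q = Suc (Suc m)"
    have q: "q \<in> {1..k}" "q \<in> {2..k}" using Suc.prems by (auto simp: q_def)
    let ?\<beta> = "mat_chain m ?a ?Y"
    have "mat_chain (Suc m) ?ar ?Yr = ?ar q ** (?H ** ?\<beta>)"
      using Suc by (simp add: q_def)
    \<comment> \<open>Moving the constant vector under the derivative produces a projected solution
      with right-hand side \<open>?\<beta>\<close> and left factor \<open>?H ** N s\<close>.\<close>
    also have "\<dots> = mat_deriv (l q) (\<lambda>s. ?H ** N s ** V ** ?Er s ** (?H ** ?\<beta>)) (\<sigma> q)"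
      by (rule mat_deriv_mult_right[symmetric])
        (intro mat_analytic_at_mult mat_analytic_at_const N Er q)
    also have "\<dots> = mat_deriv (l q) (\<lambda>s. ?H ** N s ** ?E s ** ?\<beta>) (\<sigma> q)"
      by (rule mat_deriv_projected_solution[OF K inv _ mat_analytic_at_const vq])
        (use q in \<open>auto intro!: mat_analytic_at_mult mat_analytic_at_const N simp: q_def\<close>)
    also have "\<dots> = mat_deriv (l q) (\<lambda>s. ?H ** (N s ** ?E s ** ?\<beta>)) (\<sigma> q)"
      by (simp add: matrix_mul_assoc)
    also have "\<dots> = ?H ** (?a q ** ?\<beta>)"
      by (simp only: mat_deriv_mult_left mat_deriv_mult_right mat_analytic_at_mult
          mat_analytic_at_const N E q)
    finally show ?case by (simp add: q_def)
  qed
  show ?thesis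
  proof (intro conjI ballI allI impI)
    fix j assume j: "j \<le> l 1"
    have "mat_deriv j (\<lambda>s. C s ** V ** ?Er s ** ?Br s) (\<sigma> 1) =
        mat_deriv j (\<lambda>s. C s ** ?E s ** B s) (\<sigma> 1)"
      by (rule mat_deriv_projected_solution[OF K inv C B v1 j]) (use one in auto)
    then show "mixed_partial 1 (l(1 := j)) (transfer_fun C K N B 1) \<sigma> =
        mixed_partial 1 (l(1 := j)) (reduced_transfer_fun W V C K N B 1) \<sigma>"
      unfolding reduced_transfer_fun_def
        mixed_partial_transfer_fun_1[where C = C and K = K and B = B and \<sigma> = \<sigma>,
          OF C[OF one] E[OF one] B[OF one]]
        mixed_partial_transfer_fun_1[where C = "\<lambda>s. C s ** V" and K = ?Kr and B = ?Br and \<sigma> = \<sigma>,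
          OF Cr[OF one] Er[OF one] Br[OF one]]
      by simp
  next
    fix q j assume q: "q \<in> {2..k}" and j: "j \<le> l q"
    then obtain m where m: "q = Suc (Suc m)"
      by (metis atLeastAtMost_iff add_2_eq_Suc le_Suc_ex)
    have q1: "q \<in> {1..k}" and i: "\<And>i. i \<in> {1..q} \<Longrightarrow> i \<in> {1..k}"
      using q by auto
    let ?\<beta> = "mat_chain m ?a ?Y"
    \<comment> \<open>The chain reads only the indices from 2 to q - 1, so changing the order at
      \<open>q\<close> leaves it alone. The dimension is kept general to serve both the full and the
      reduced system.\<close>
    have upd: "mat_chain m (\<lambda>i. mat_deriv ((l(q := j)) i) D (\<sigma> i)) Z =
        mat_chain m (\<lambda>i. mat_deriv (l i) D (\<sigma> i)) Z"
      for D :: "complex \<Rightarrow> complex^'d^'d" and Z :: "complex^1^'d"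
      by (rule mat_chain_cong) (auto simp: m)
    have upd1: "(l(q := j)) 1 = l 1"
      by (simp add: m)
    have "mixed_partial q (l(q := j)) (transfer_fun C K N B q) \<sigma> =
        (mat_deriv j (\<lambda>s. C s ** ?E s) (\<sigma> q) ** ?\<beta>) $ 1 $ 1"
      by (simp only: mixed_partial_transfer_fun[OF m C E N B] i upd upd1 fun_upd_same)
    also have "mat_deriv j (\<lambda>s. C s ** ?E s) (\<sigma> q) ** ?\<beta> =
        mat_deriv j (\<lambda>s. C s ** ?E s ** ?\<beta>) (\<sigma> q)"
      by (intro mat_deriv_mult_right[symmetric] mat_analytic_at_mult C E q1)
    also have "\<dots> = mat_deriv j (\<lambda>s. C s ** V ** ?Er s ** (?H ** ?\<beta>)) (\<sigma> q)"
      by (rule mat_deriv_projected_solution[OF K inv C mat_analytic_at_const vq[OF m q] j, symmetric])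
        (use q1 in auto)
    \<comment> \<open>\<open>?H ** ?\<beta>\<close> is constant, so it leaves the derivative, and
      \<open>chain\<close> identifies it with the vector of the reduced system.\<close>
    also have "\<dots> = mat_deriv j (\<lambda>s. C s ** V ** ?Er s) (\<sigma> q) ** mat_chain m ?ar ?Yr"
      using q chain[of m] mat_deriv_mult_right[OF mat_analytic_at_mult[OF Cr Er, OF q1 q1]]
      by (simp add: m)
    also have "(\<dots>) $ 1 $ 1 = mixed_partial q (l(q := j)) (reduced_transfer_fun W V C K N B q) \<sigma>"
      unfolding reduced_transfer_fun_def
      by (simp only: mixed_partial_transfer_fun[where K = ?Kr, OF m Cr Er Nr Br] i
          upd upd1 fun_upd_same)
    finally show "mixed_partial q (l(q := j)) (transfer_fun C K N B q) \<sigma> =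
        mixed_partial q (l(q := j)) (reduced_transfer_fun W V C K N B q) \<sigma>" .
  qed
qed

end
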